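(* Let $N,S$ be positive integers and let $e_n(s)\in\{-1,+1\}$ ($1\le n\le N$, $1\le s\le S$) be chosen independently and uniformly at random; put $G_{N,S}(s)=(e_1(s),\dots,e_N(s))$. For any fixed constant $\varepsilon>0$ and any integer function $k=k(N)$ with $2\le k\le (\log N+\log S)/\log\log N$, there is a constant $N_0\ge 12\log_2 S$ such that for all $N\ge N_0$ the probability that \[ 1-\varepsilon<\frac{\Phi_k(G_{N,S})}{\mathbb{E}[\Phi_k(G_{N,S})]}<1+\varepsilon \] holds is at least $1-\varepsilon$.
   Context: For a map $G_{N,S}:\{1,\dots,S\}\to\{-1,+1\}^N$, $G_{N,S}(s)=(e_1(s),\dots,e_N(s))$, the cross-correlation measure of order $k$ is \[ \Phi_k(G_{N,S})=\max\left|\sum_{n=1}^M e_{n+d_1}(s_1)\cdots e_{n+d_k}(s_k)\right|, \] the maximum taken over all integers $M,d_1,\dots,d_k$ and $1\le s_1,\dots,s_k\le S$ with $0\le d_1\le d_2\le\dots\le d_k<M+d_k\le N$ and $d_i\ne d_j$ whenever $s_i=s_j$. $\log$ denotes the natural logarithm. *)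

theory Defs
  imports "HOL-Probability.Probability"
begin

text \<open>A sign array: e n s \<in> {-1,+1} for 1 \<le> n \<le> N, 1 \<le> s \<le> S, and 0 elsewhere
  (extensional, so that the set of all such arrays is finite and in bijection
  with the maps G_{N,S}).\<close>
definition sign_arrays :: "nat \<Rightarrow> nat \<Rightarrow> (nat \<Rightarrow> nat \<Rightarrow> real) set" where
  "sign_arrays N S = {e. \<forall>n s. (n \<in> {1..N} \<and> s \<in> {1..S} \<longrightarrow> e n s \<in> {-1, 1})
                              \<and> (\<not> (n \<in> {1..N} \<and> s \<in> {1..S}) \<longrightarrow> e n s = 0)}"

text \<open>Admissible parameters (M, d_1..d_k, s_1..s_k) for the cross-correlation measure
  of order k; lists are 0-indexed: d ! i = d_{i+1}, s ! i = s_{i+1}.\<close>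
definition admissible :: "nat \<Rightarrow> nat \<Rightarrow> nat \<Rightarrow> nat \<Rightarrow> nat list \<Rightarrow> nat list \<Rightarrow> bool" where
  "admissible N S k M d s \<longleftrightarrow>
     length d = k \<and> length s = k \<and>
     (\<forall>i<k. 1 \<le> s ! i \<and> s ! i \<le> S) \<and>
     (\<forall>i j. i \<le> j \<and> j < k \<longrightarrow> d ! i \<le> d ! j) \<and>
     (\<forall>i<k. d ! i < M + d ! i \<and> M + d ! i \<le> N) \<and>
     (\<forall>i j. i < k \<and> j < k \<and> i \<noteq> j \<and> s ! i = s ! j \<longrightarrow> d ! i \<noteq> d ! j)"

definition cross_corr :: "nat \<Rightarrow> nat \<Rightarrow> nat \<Rightarrow> (nat \<Rightarrow> nat \<Rightarrow> real) \<Rightarrow> real" where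
  "cross_corr N S k e =
     Max {\<bar>\<Sum>n = 1..M. \<Prod>i<k. e (n + d ! i) (s ! i)\<bar> | M d s. admissible N S k M d s}"

end

theory Submission
  imports Defs "HOL-Real_Asymp.Real_Asymp"
begin

text \<open>
  Flipping one sign changes \<open>\<Phi>\<^sub>k\<close> by at most \<open>2k\<close>, so by the Efron--Stein inequality its variance is
  at most \<open>NSk\<^sup>2\<close>. By Chebyshev's inequality it is enough that the mean \<open>\<mu>\<close> satisfies
  \<open>\<mu>\<^sup>2 \<ge> c N k log N\<close> with an absolute constant \<open>c > 0\<close>, because \<open>k / log N \<rightarrow> 0\<close> for fixed \<open>S\<close>.

  For this lower bound put \<open>M = \<lfloor>N/3\<rfloor>\<close> and consider the sums
  \<open>X\<^sub>A = \<Sum>\<^sub>n\<^sub>\<le>\<^sub>M e\<^sub>n \<Prod>\<^sub>a\<^sub>\<in>\<^sub>A e\<^sub>n\<^sub>+\<^sub>a\<close> over the \<open>(k-1)\<close>-subsets \<open>A\<close> of \<open>{M..N-M}\<close>, all taken from the first sequence.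
  The partition function \<open>W = \<Sum>\<^sub>A exp (t X\<^sub>A)\<close> has a second moment close to \<open>(E W)\<^sup>2\<close>: conditionally on
  the signs with index larger than \<open>M\<close>, the pair \<open>A, B\<close> contributes \<open>exp (b (M + Q))\<close>, where
  \<open>exp (2b) = cosh (2t)\<close> and \<open>Q = \<Sum>\<^sub>n\<^sub>\<le>\<^sub>M \<Prod>\<^sub>a e\<^sub>n\<^sub>+\<^sub>a\<close> over the symmetric difference of \<open>A\<close> and \<open>B\<close> is a
  simple random walk. Hence \<open>W \<ge> E W / 2\<close> with probability at least one half, and then
  \<open>\<Phi>\<^sub>k \<ge> log (W / card F) / t\<close> with \<open>F\<close> the family of all these \<open>A\<close>.
\<close>

section \<open>Averages over the discrete cube\<close>

text \<open>Points are extended by the default 0 off \<open>I\<close>. This keeps the set finite and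
  matches the convention of \<open>sign_arrays\<close>, so that no transfer of probability spaces is
  needed.\<close>

abbreviation cube :: "'i set \<Rightarrow> ('i \<Rightarrow> real) set" where
  "cube I \<equiv> PiE_dflt I 0 (\<lambda>_. {-1, 1})"

definition mean :: "'i set \<Rightarrow> (('i \<Rightarrow> real) \<Rightarrow> real) \<Rightarrow> real" where
  "mean I f = (\<Sum>x\<in>cube I. f x) / 2 ^ card I"

definition flip :: "'i \<Rightarrow> ('i \<Rightarrow> real) \<Rightarrow> 'i \<Rightarrow> real" where
  "flip i x = x(i := - x i)"

lemma flip_flip [simp]: "flip i (flip i x) = x"
  by (simp add: flip_def)

lemma flip_apply_same [simp]: "flip i x i = - x i"
  by (simp add: flip_def)

lemma flip_apply_other [simp]: "j \<noteq> i \<Longrightarrow> flip i x j = x j"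
  by (simp add: flip_def)

lemma cube_values: "x \<in> cube I \<Longrightarrow> i \<in> I \<Longrightarrow> x i = 1 \<or> x i = -1"
  by (auto simp: PiE_dflt_def)

lemma flip_in_cube: "x \<in> cube I \<Longrightarrow> flip i x \<in> cube I"
  by (cases "i \<in> I") (auto simp: PiE_dflt_def flip_def)

lemma finite_cube: "finite I \<Longrightarrow> finite (cube I)"
  by (auto intro: finite_PiE_dflt)

lemma card_cube: "finite I \<Longrightarrow> card (cube I) = 2 ^ card I"
  by (simp add: card_PiE_dflt numeral_2_eq_2)

lemma mean_cong: "(\<And>x. x \<in> cube I \<Longrightarrow> f x = g x) \<Longrightarrow> mean I f = mean I g"
  by (simp add: mean_def)

lemma mean_mono: "(\<And>x. x \<in> cube I \<Longrightarrow> f x \<le> g x) \<Longrightarrow> mean I f \<le> mean I g"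
  by (auto simp: mean_def intro!: divide_right_mono sum_mono)

lemma mean_const: "finite I \<Longrightarrow> mean I (\<lambda>_. c) = c"
  by (simp add: mean_def card_cube)

lemma mean_add: "mean I (\<lambda>x. f x + g x) = mean I f + mean I g"
  by (simp add: mean_def sum.distrib add_divide_distrib)

lemma mean_diff: "mean I (\<lambda>x. f x - g x) = mean I f - mean I g"
  by (simp add: mean_def sum_subtractf diff_divide_distrib)

lemma mean_cmult: "mean I (\<lambda>x. c * f x) = c * mean I f"
  by (simp add: mean_def sum_distrib_left)

lemma mean_sum: "mean I (\<lambda>x. \<Sum>a\<in>A. f a x) = (\<Sum>a\<in>A. mean I (f a))"
  unfolding mean_def by (subst sum.swap) (simp add: sum_divide_distrib)

lemma mean_flip: "mean I (\<lambda>x. f (flip i x)) = mean I f"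
proof -
  have "(\<Sum>x\<in>cube I. f (flip i x)) = (\<Sum>x\<in>cube I. f x)"
    by (rule sum.reindex_bij_witness[of _ "flip i" "flip i"]) (auto simp: flip_in_cube)
  then show ?thesis
    by (simp add: mean_def)
qed

lemma mean_sq_diff:
  assumes "finite I"
  shows "mean I (\<lambda>x. (f x - c)\<^sup>2) = mean I (\<lambda>x. (f x)\<^sup>2) - 2 * c * mean I f + c\<^sup>2"
proof -
  have "mean I (\<lambda>x. (f x - c)\<^sup>2) = mean I (\<lambda>x. (f x)\<^sup>2 - (2 * c) * f x + c\<^sup>2)"
    by (rule mean_cong) (simp add: power2_eq_square algebra_simps)
  then show ?thesis
    by (simp only: mean_add mean_diff mean_cmult mean_const[OF assms])
qed

section \<open>Averaging out one coordinate, and the variance bound\<close>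

lemma mean_insert:
  assumes "finite I" "i \<notin> I"
  shows "mean (insert i I) f = mean I (\<lambda>x. (f (x(i := 1)) + f (x(i := -1))) / 2)"
proof -
  have cube: "cube (insert i I) = (\<lambda>x. x(i := 1)) ` cube I \<union> (\<lambda>x. x(i := -1)) ` cube I"
  proof (intro equalityI subsetI)
    fix x :: "'a \<Rightarrow> real" assume x: "x \<in> cube (insert i I)"
    \<comment> \<open>Resetting coordinate \<open>i\<close> to the default 0 yields the preimage in
      \<open>cube I\<close>.\<close>
    have "x = (x(i := 0))(i := x i)" "x(i := 0) \<in> cube I"
      using x assms by (auto simp: PiE_dflt_def)
    moreover have "x i = 1 \<or> x i = -1"
      using x by (auto simp: PiE_dflt_def)
    ultimately show "x \<in> (\<lambda>x. x(i := 1)) ` cube I \<union> (\<lambda>x. x(i := -1)) ` cube I"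
      by (metis UnCI image_eqI)
  next
    fix x assume "x \<in> (\<lambda>x. x(i := 1)) ` cube I \<union> (\<lambda>x. x(i := -1)) ` cube I"
    then show "x \<in> cube (insert i I)"
      using assms by (auto simp: PiE_dflt_def split: if_splits)
  qed
  have inj: "inj_on (\<lambda>x. x(i := c)) (cube I)" for c :: real
  proof (rule inj_onI)
    fix x y :: "'a \<Rightarrow> real" assume "x \<in> cube I" "y \<in> cube I" "x(i := c) = y(i := c)"
    then show "x = y"
      using assms(2) by (auto simp: PiE_dflt_def fun_eq_iff split: if_splits) metis+
  qed
  have disj: "(\<lambda>x. x(i := 1)) ` cube I \<inter> (\<lambda>x. x(i := -1)) ` cube I = {}"
    by (auto simp: fun_eq_iff) (metis one_neq_neg_one)
  have "(\<Sum>x\<in>cube (insert i I). f x)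
      = (\<Sum>x\<in>cube I. f (x(i := 1))) + (\<Sum>x\<in>cube I. f (x(i := -1)))"
    unfolding cube using disj finite_cube[OF assms(1)]
    by (subst sum.union_disjoint) (auto simp: sum.reindex[OF inj])
  then show ?thesis
    using assms by (simp add: mean_def sum.distrib flip: sum_divide_distrib)
qed

text \<open>Induction on the coordinates. Averaging out one sign loses the variance of a quantity
  with two equally likely values at distance at most \<open>c\<close>, hence at most
  \<open>c\<^sup>2 / 4\<close>.\<close>

lemma efron_stein_bounded_differences:
  fixes c :: real
  assumes "finite I"
    and "\<And>i x. i \<in> I \<Longrightarrow> x \<in> cube I \<Longrightarrow> \<bar>f (flip i x) - f x\<bar> \<le> c"
  shows "mean I (\<lambda>x. (f x - mean I f)\<^sup>2) \<le> card I * c\<^sup>2 / 4"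
proof -
  have "mean I (\<lambda>x. (f x)\<^sup>2) - (mean I f)\<^sup>2 \<le> card I * c\<^sup>2 / 4"
    using assms
  proof (induction I arbitrary: f rule: finite_induct)
    case empty
    have "cube {} = {\<lambda>_::'a. 0 :: real}"
      by (auto simp: PiE_dflt_def)
    then show ?case by (simp add: mean_def)
  next
    case (insert i I)
    \<comment> \<open>\<open>g\<close> averages out coordinate \<open>i\<close> and inherits the bounded differences; \<open>h\<close> carries the lost variance.\<close>
    define g where "g x = (f (x(i := 1)) + f (x(i := -1))) / 2" for x
    define h where "h x = (f (x(i := 1)) - f (x(i := -1))) / 2" for x
    have upd: "x(i := b) \<in> cube (insert i I)" if "x \<in> cube I" "b = 1 \<or> b = -1" for x and b :: real
      using that by (auto simp: PiE_dflt_def)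
    have h: "(h x)\<^sup>2 \<le> c\<^sup>2 / 4" if "x \<in> cube I" for x
    proof -
      have "\<bar>f (flip i (x(i := -1))) - f (x(i := -1))\<bar> \<le> c"
        by (intro insert.prems insertI1 upd[OF that] disjI2 refl)
      moreover have "flip i (x(i := -1)) = x(i := 1)"
        by (simp add: flip_def)
      ultimately have "\<bar>h x\<bar> \<le> c / 2"
        by (simp add: h_def)
      then have "(h x)\<^sup>2 \<le> (c / 2)\<^sup>2"
        by (metis abs_ge_zero power2_abs power_mono)
      then show ?thesis
        by (simp add: power_divide)
    qed
    have g: "\<bar>g (flip j x) - g x\<bar> \<le> c" if "j \<in> I" "x \<in> cube I" for j x
    proof -
      have ji: "j \<noteq> i"
        using that insert.hyps by auto
      have upd_flip: "(flip j x)(i := b) = flip j (x(i := b))" for b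
        using ji by (auto simp: flip_def)
      have "\<bar>f (flip j (x(i := b))) - f (x(i := b))\<bar> \<le> c" if "b = 1 \<or> b = -1" for b
        by (intro insert.prems insertI2 \<open>j \<in> I\<close> upd[OF \<open>x \<in> cube I\<close> that])
      from this[of 1] this[of "-1"] have
        "\<bar>f (flip j (x(i := 1))) - f (x(i := 1))\<bar> \<le> c" "\<bar>f (flip j (x(i := -1))) - f (x(i := -1))\<bar> \<le> c"
        by auto
      moreover have "\<bar>(p + q) / 2 - (r + s) / 2\<bar> \<le> c" if "\<bar>p - r\<bar> \<le> c" "\<bar>q - s\<bar> \<le> c" for p q r s
        using that by (auto simp: abs_le_iff field_simps)
      ultimately show ?thesis
        unfolding g_def upd_flip by blast
    qed
    \<comment> \<open>With \<open>p\<close>, \<open>q\<close> the values of \<open>f\<close> at the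
      two signs, this is \<open>(p\<^sup>2 + q\<^sup>2) / 2 = ((p + q) / 2)\<^sup>2 + ((p - q) /
      2)\<^sup>2\<close>.\<close>
    have "mean (insert i I) (\<lambda>x. (f x)\<^sup>2) = mean I (\<lambda>x. (g x)\<^sup>2 + (h x)\<^sup>2)"
      unfolding mean_insert[OF insert.hyps(1,2)]
      by (rule mean_cong) (simp add: g_def h_def power2_eq_square field_simps)
    also have "\<dots> \<le> mean I (\<lambda>x. (g x)\<^sup>2) + c\<^sup>2 / 4"
      using mean_mono[of I "\<lambda>x. (h x)\<^sup>2" "\<lambda>_. c\<^sup>2 / 4"] h mean_const[OF insert.hyps(1)]
      by (simp add: mean_add)
    finally have "mean (insert i I) (\<lambda>x. (f x)\<^sup>2) - (mean (insert i I) f)\<^sup>2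
        \<le> mean I (\<lambda>x. (g x)\<^sup>2) + c\<^sup>2 / 4 - (mean I g)\<^sup>2"
      by (simp add: mean_insert[OF insert.hyps(1,2)] g_def[abs_def])
    also have "\<dots> \<le> card I * c\<^sup>2 / 4 + c\<^sup>2 / 4"
      using insert.IH[of g] g by auto
    finally show ?case
      using insert.hyps by (simp add: field_simps)
  qed
  then show ?thesis
    unfolding mean_sq_diff[OF assms(1)] by (simp add: power2_eq_square)
qed

section \<open>Exponential moments of sums of signs\<close>

lemma mean_exp_sign:
  assumes "i \<in> I" "\<And>x. G (flip i x) = G x" "\<And>x. u (flip i x) = u x"
  shows "mean I (\<lambda>x. G x * exp (x i * u x)) = mean I (\<lambda>x. G x * cosh (u x))"
proof -
  let ?f = "\<lambda>x. G x * exp (x i * u x)"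
  \<comment> \<open>Pairing \<open>x\<close> with \<open>flip i x\<close> symmetrises the
    exponential into cosh, which integrates out the sign at \<open>i\<close> given all the
    others.\<close>
  have "2 * mean I ?f = mean I ?f + mean I (\<lambda>x. ?f (flip i x))"
    using mean_flip[of I ?f i] by simp
  also have "\<dots> = mean I (\<lambda>x. 2 * (G x * cosh (u x)))"
    unfolding mean_add[symmetric]
    by (rule mean_cong, drule cube_values[OF _ assms(1)])
       (auto simp: assms(2,3) cosh_def field_simps)
  also have "\<dots> = 2 * mean I (\<lambda>x. G x * cosh (u x))"
    by (simp add: mean_cmult)
  finally show ?thesis
    by simp
qed

text \<open>Iterates the previous step. The weight \<open>G\<close> serves the induction: it
  collects the cosh factors already produced.\<close>

lemma mean_exp_linear:
  assumes "finite J" "inj_on p J" "p ` J \<subseteq> I"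
    and "\<And>j x. j \<in> J \<Longrightarrow> G (flip (p j) x) = G x"
    and "\<And>i j x. i \<in> J \<Longrightarrow> j \<in> J \<Longrightarrow> u i (flip (p j) x) = u i x"
  shows "mean I (\<lambda>x. G x * exp (\<Sum>j\<in>J. x (p j) * u j x)) = mean I (\<lambda>x. G x * (\<Prod>j\<in>J. cosh (u j x)))"
  using assms
proof (induction J arbitrary: G rule: finite_induct)
  case empty
  then show ?case by simp
next
  case (insert i J)
  let ?E = "\<lambda>x. \<Sum>j\<in>J. x (p j) * u j x"
  have pij: "p j \<noteq> p i" if "j \<in> J" for j
    using that insert.prems(1) insert.hyps by (auto simp: inj_on_def)
  have "mean I (\<lambda>x. G x * exp (\<Sum>j\<in>insert i J. x (p j) * u j x))
      = mean I (\<lambda>x. (G x * exp (?E x)) * exp (x (p i) * u i x))"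
    using insert.hyps by (simp add: exp_add mult_ac)
  also have "\<dots> = mean I (\<lambda>x. (G x * exp (?E x)) * cosh (u i x))"
    using insert.prems pij by (intro mean_exp_sign) auto
  also have "\<dots> = mean I (\<lambda>x. (G x * cosh (u i x)) * exp (?E x))"
    by (simp add: mult_ac)
  also have "\<dots> = mean I (\<lambda>x. (G x * cosh (u i x)) * (\<Prod>j\<in>J. cosh (u j x)))"
    using insert.prems by (intro insert.IH) auto
  finally show ?case
    using insert.hyps by (simp add: mult_ac)
qed

text \<open>The sign \<open>x (p n)\<close> is fresh at step \<open>n\<close>, so the exponent is a simple random walk even though
  \<open>r n\<close> may depend on earlier signs.\<close>

lemma mean_exp_adapted:
  fixes p :: "nat \<Rightarrow> 'i"
  assumes "finite I" "inj_on p {1..M}" "p ` {1..M} \<subseteq> I"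
    and "\<And>m n x. 1 \<le> m \<Longrightarrow> m \<le> n \<Longrightarrow> n \<le> M \<Longrightarrow> r m (flip (p n) x) = r m x"
    and "\<And>n x. 1 \<le> n \<Longrightarrow> n \<le> M \<Longrightarrow> x \<in> cube I \<Longrightarrow> r n x = 1 \<or> r n x = -1"
  shows "mean I (\<lambda>x. exp (a * (\<Sum>n=1..M. x (p n) * r n x))) = cosh a ^ M"
  using assms
proof (induction M)
  case 0
  then show ?case by (simp add: mean_const)
next
  case (Suc M)
  let ?E = "\<lambda>x. a * (\<Sum>n=1..M. x (p n) * r n x)"
  have pij: "p j \<noteq> p (Suc M)" if "1 \<le> j" "j \<le> M" for j
    using that Suc.prems(2) by (force simp: inj_on_def)
  have "mean I (\<lambda>x. exp (a * (\<Sum>n=1..Suc M. x (p n) * r n x)))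
      = mean I (\<lambda>x. exp (?E x) * exp (x (p (Suc M)) * (a * r (Suc M) x)))"
    by (simp add: exp_add[symmetric] algebra_simps)
  also have "\<dots> = mean I (\<lambda>x. exp (?E x) * cosh (a * r (Suc M) x))"
    using Suc.prems(3,4) pij by (intro mean_exp_sign) (auto intro!: sum.cong)
  \<comment> \<open>\<open>r (Suc M) x\<close> is a sign and cosh is even, so the factor no longer
    depends on \<open>x\<close>.\<close>
  also have "\<dots> = mean I (\<lambda>x. cosh a * exp (?E x))"
    using Suc.prems(5)[of "Suc M"] by (intro mean_cong) force
  also have "\<dots> = cosh a * cosh a ^ M"
    unfolding mean_cmult using Suc.prems by (subst Suc.IH) (auto simp: inj_on_def)
  finally show ?case
    by simp
qed

section \<open>Quadratic bounds for cosh\<close>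

lemma cosh_le_one_plus_square:
  fixes x :: real
  assumes "0 \<le> x" "x \<le> 1"
  shows "cosh x \<le> 1 + x\<^sup>2"
proof -
  have "exp x \<le> 1 + x + x\<^sup>2"
    using exp_bound assms by auto
  moreover have "exp (- x) \<le> 1 - x + x\<^sup>2"
  proof -
    \<comment> \<open>The product is \<open>1 + x ^ 3\<close>.\<close>
    have "1 \<le> (1 - x + x\<^sup>2) * (1 + x)"
      using assms by (simp add: algebra_simps power2_eq_square)
    also have "\<dots> \<le> (1 - x + x\<^sup>2) * exp x"
      using assms by (intro mult_left_mono) auto
    finally show ?thesis
      by (simp add: exp_minus field_simps)
  qed
  ultimately show ?thesis
    by (simp add: cosh_def)
qed

lemma cosh_le_exp_square:
  fixes x :: real
  assumes "0 \<le> x" "x \<le> 1"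
  shows "cosh x \<le> exp (x\<^sup>2)"
  using cosh_le_one_plus_square[OF assms] exp_ge_add_one_self[of "x\<^sup>2"] by linarith

text \<open>Turns the factor \<open>cosh t ^ M\<close> in the mean of the partition function into a
  Gaussian exponent. The half-angle formula and \<open>sinh (t/2) \<ge> t/2\<close> give
  \<open>cosh t \<ge> 1 + t\<^sup>2 / 2\<close>, which leaves room for the exponential.\<close>

lemma exp_le_cosh:
  fixes t :: real
  assumes "0 \<le> t" "t \<le> 1"
  shows "exp (t\<^sup>2 / 4) \<le> cosh t"
proof -
  have "exp (t\<^sup>2 / 4) \<le> 1 + t\<^sup>2 / 4 + (t\<^sup>2 / 4)\<^sup>2"
    using assms power_le_one[of t 2] by (intro exp_bound) auto
  also have "\<dots> \<le> 1 + t\<^sup>2 / 2"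
  proof -
    have "t\<^sup>2 * t\<^sup>2 \<le> t\<^sup>2 * 1"
      using assms by (intro mult_left_mono) (auto simp: power_le_one)
    moreover have "(t\<^sup>2 / 4)\<^sup>2 = t\<^sup>2 * t\<^sup>2 / 16"
      by (simp add: power2_eq_square)
    moreover have "0 \<le> t\<^sup>2" by simp
    ultimately show ?thesis by linarith
  qed
  also have "\<dots> \<le> cosh t"
  proof -
    have "cosh t = 1 + 2 * (sinh (t/2))\<^sup>2"
      using cosh_double[of "t/2"] cosh_square_eq[of "t/2"] by simp
    moreover have "t / 2 \<le> sinh (t/2)"
      using assms real_le_x_sinh[of "t/2"] by (simp add: sinh_def exp_minus)
    ultimately show ?thesis
      using assms power_mono[of "t/2" "sinh (t/2)" 2] by (simp add: power_divide)
  qed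
  finally show ?thesis .
qed

section \<open>Second moment of the partition function\<close>

definition shift_prod :: "nat set \<Rightarrow> nat \<Rightarrow> (nat \<times> nat \<Rightarrow> real) \<Rightarrow> real" where
  "shift_prod A n x = (\<Prod>a\<in>A. x (n + a, 1))"

text \<open>The sum \<open>X\<^sub>A\<close> of the overview. The lag 0 is kept apart from
  \<open>A\<close> because the signs \<open>x (n, 1)\<close> with \<open>n \<le> M\<close> are
  integrated out first.\<close>

definition shift_sum :: "nat \<Rightarrow> nat set \<Rightarrow> (nat \<times> nat \<Rightarrow> real) \<Rightarrow> real" where
  "shift_sum M A x = (\<Sum>n=1..M. x (n, 1) * shift_prod A n x)"

lemma shift_prod_flip:
  "m \<notin> (+) n ` A \<Longrightarrow> shift_prod A n (flip (m, 1) x) = shift_prod A n x"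
  unfolding shift_prod_def by (rule prod.cong) (auto intro: flip_apply_other)

lemma shift_prod_sign:
  assumes "\<And>a. a \<in> A \<Longrightarrow> x (n + a, 1) = 1 \<or> x (n + a, 1) = -1"
  shows "shift_prod A n x = 1 \<or> shift_prod A n x = -1"
proof -
  have "\<bar>shift_prod A n x\<bar> = (\<Prod>a\<in>A. 1)"
    unfolding shift_prod_def abs_prod by (intro prod.cong) (auto dest: assms)
  then show ?thesis by auto
qed

text \<open>Signs at shifts common to both sets occur squared and cancel.\<close>

lemma shift_prod_mult:
  assumes "finite A" "finite B"
    and "\<And>a. a \<in> A \<union> B \<Longrightarrow> x (n + a, 1) = 1 \<or> x (n + a, 1) = -1"
  shows "shift_prod A n x * shift_prod B n x = shift_prod ((A - B) \<union> (B - A)) n x"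
proof -
  have split: "shift_prod C n x = shift_prod (C - D) n x * shift_prod (C \<inter> D) n x" if "finite C" for C D
    unfolding shift_prod_def
    by (subst prod.union_disjoint[symmetric]) (use that in \<open>auto intro!: prod.cong\<close>)
  have "shift_prod (A \<inter> B) n x * shift_prod (A \<inter> B) n x = 1"
    using shift_prod_sign[of "A \<inter> B" x n] assms(3) by auto
  moreover have "shift_prod ((A - B) \<union> (B - A)) n x = shift_prod (A - B) n x * shift_prod (B - A) n x"
    unfolding shift_prod_def using assms(1,2) by (intro prod.union_disjoint) auto
  ultimately show ?thesis
    using split[OF assms(1), of B] split[OF assms(2), of A] by (simp add: Int_commute mult_ac)
qed

text \<open>The parameter \<open>t\<close> is an inverse temperature. For
  \<open>1 \<le> n \<le> M\<close> and a shift \<open>a\<close> in \<open>{M..N-M}\<close> the index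
  \<open>n + a\<close> lies in \<open>{M+1..N}\<close>, so the shifted products never meet the low
  signs, those with index at most \<open>M\<close>.\<close>

locale shifts =
  fixes M N :: nat and I :: "(nat \<times> nat) set" and t :: real
  assumes fin: "finite I" and rows: "{1..N} \<times> {1} \<subseteq> I" and MN: "2 * M \<le> N"
    and t: "0 \<le> t" "t \<le> 1/2"
begin

lemma sign_at: "x \<in> cube I \<Longrightarrow> n \<in> {1..M} \<Longrightarrow> a \<in> {M..N-M} \<Longrightarrow> x (n + a, 1) = 1 \<or> x (n + a, 1) = -1"
  using rows MN by (intro cube_values[of x I]) auto

lemma shift_prod_cases:
  assumes "x \<in> cube I" "n \<in> {1..M}" "A \<subseteq> {M..N-M}"
  shows "shift_prod A n x = 1 \<or> shift_prod A n x = -1"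
  using assms by (intro shift_prod_sign sign_at) auto

lemma mean_exp_free_linear:
  assumes "\<And>n m x. n \<in> {1..M} \<Longrightarrow> m \<in> {1..M} \<Longrightarrow> u n (flip (m, 1) x) = u n x"
  shows "mean I (\<lambda>x. exp (\<Sum>n=1..M. x (n, 1) * u n x)) = mean I (\<lambda>x. \<Prod>n=1..M. cosh (u n x))"
proof -
  have "mean I (\<lambda>x. 1 * exp (\<Sum>n=1..M. x (n, 1) * u n x)) = mean I (\<lambda>x. 1 * (\<Prod>n=1..M. cosh (u n x)))"
    using rows MN assms by (intro mean_exp_linear) (auto simp: inj_on_def)
  then show ?thesis by simp
qed

lemma shift_prod_flip_low:
  "A \<subseteq> {M..N-M} \<Longrightarrow> n \<in> {1..M} \<Longrightarrow> m \<in> {1..M} \<Longrightarrow> shift_prod A n (flip (m, 1) x) = shift_prod A n x"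
  by (rule shift_prod_flip) force

lemma mean_exp_shift_sum:
  assumes "A \<subseteq> {M..N-M}"
  shows "mean I (\<lambda>x. exp (t * shift_sum M A x)) = cosh t ^ M"
proof -
  have "mean I (\<lambda>x. exp (t * shift_sum M A x))
      = mean I (\<lambda>x. exp (\<Sum>n=1..M. x (n, 1) * (t * shift_prod A n x)))"
    by (simp add: shift_sum_def sum_distrib_left mult_ac)
  also have "\<dots> = mean I (\<lambda>x. \<Prod>n=1..M. cosh (t * shift_prod A n x))"
    by (rule mean_exp_free_linear) (simp only: shift_prod_flip_low[OF assms])
  also have "\<dots> = mean I (\<lambda>_. \<Prod>n=1..M. cosh t)"
    using shift_prod_cases[OF _ _ assms] by (intro mean_cong prod.cong refl) force
  finally show ?thesis
    by (simp add: mean_const[OF fin])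
qed

text \<open>For signs \<open>p\<close>, \<open>p'\<close> with product \<open>q\<close>,
  \<open>cosh (t * p + t * p')\<close> is \<open>cosh (2 * t)\<close> if \<open>q = 1\<close> and 1
  if \<open>q = -1\<close>. This \<open>b\<close> makes it equal to \<open>exp (b * (1 + q))\<close>
  in both cases.\<close>

definition b :: real where "b = ln (cosh (2 * t)) / 2"

lemma b_nonneg: "0 \<le> b"
  by (simp add: b_def cosh_real_ge_1)

lemma exp_2b: "exp (b * 2) = cosh (2 * t)"
  by (simp add: b_def)

lemma b_le: "b \<le> 2 * t\<^sup>2"
proof -
  have "exp (b * 2) \<le> exp ((2 * t)\<^sup>2)"
    unfolding exp_2b using t by (intro cosh_le_exp_square) auto
  then show ?thesis by (simp add: power2_eq_square)
qed

lemma exp_b_le: "exp b \<le> (cosh t)\<^sup>2"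
proof -
  have "(exp b)\<^sup>2 = cosh (2 * t)"
    by (simp add: exp_2b[symmetric] power2_eq_square exp_add[symmetric])
  also have "\<dots> = 2 * (cosh t)\<^sup>2 - 1"
    using cosh_double_cosh[of t] by simp
  \<comment> \<open>With \<open>y = (cosh t)\<^sup>2\<close> this is
    \<open>(y - 1)\<^sup>2 \<ge> 0\<close>.\<close>
  also have "\<dots> \<le> ((cosh t)\<^sup>2)\<^sup>2"
    using zero_le_power2[of "(cosh t)\<^sup>2 - 1"] by (simp add: power2_eq_square algebra_simps)
  finally show ?thesis
    by (rule power2_le_imp_le) simp
qed

text \<open>Integrating out the low signs leaves one cosh per \<open>n\<close>, which depends only
  on the product of the two shifted signs, that is, on the symmetric difference.\<close>

lemma mean_exp_pair:
  assumes "A \<subseteq> {M..N-M}" "B \<subseteq> {M..N-M}"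
  shows "mean I (\<lambda>x. exp (t * shift_sum M A x) * exp (t * shift_sum M B x))
       = exp (b * M) * mean I (\<lambda>x. exp (b * (\<Sum>n=1..M. shift_prod ((A - B) \<union> (B - A)) n x)))"
proof -
  let ?D = "(A - B) \<union> (B - A)"
  have "mean I (\<lambda>x. exp (t * shift_sum M A x) * exp (t * shift_sum M B x))
      = mean I (\<lambda>x. exp (\<Sum>n=1..M. x (n, 1) * (t * shift_prod A n x + t * shift_prod B n x)))"
    by (simp add: shift_sum_def sum_distrib_left exp_add[symmetric] sum.distrib[symmetric] algebra_simps)
  also have "\<dots> = mean I (\<lambda>x. \<Prod>n=1..M. cosh (t * shift_prod A n x + t * shift_prod B n x))"
    by (rule mean_exp_free_linear)
       (simp only: shift_prod_flip_low[OF assms(1)] shift_prod_flip_low[OF assms(2)])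
  also have "\<dots> = mean I (\<lambda>x. \<Prod>n=1..M. exp (b * (1 + shift_prod ?D n x)))"
  proof (intro mean_cong prod.cong refl)
    fix x n assume x: "x \<in> cube I" and n: "n \<in> {1..M}"
    have D: "shift_prod ?D n x = shift_prod A n x * shift_prod B n x"
    proof (rule shift_prod_mult[symmetric])
      show "finite A" "finite B"
        using assms by (auto intro: finite_subset)
      show "x (n + a, 1) = 1 \<or> x (n + a, 1) = -1" if "a \<in> A \<union> B" for a
        using that assms by (intro sign_at[OF x n]) auto
    qed
    show "cosh (t * shift_prod A n x + t * shift_prod B n x) = exp (b * (1 + shift_prod ?D n x))"
      using shift_prod_cases[OF x n assms(1)] shift_prod_cases[OF x n assms(2)] exp_2b cosh_minus[of "2 * t"]
      by (elim disjE) (simp_all add: D)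
  qed
  also have "\<dots> = mean I (\<lambda>x. exp (b * M) * exp (b * (\<Sum>n=1..M. shift_prod ?D n x)))"
    by (simp add: exp_sum[symmetric] exp_add[symmetric] sum.distrib sum_distrib_left distrib_left mult.commute)
  finally show ?thesis
    by (simp add: mean_cmult)
qed

lemma exp_bM_le: "exp (b * M) \<le> (cosh t ^ M)\<^sup>2"
proof -
  have "exp (b * M) = exp b ^ M"
    by (simp add: exp_of_nat2_mult)
  also have "\<dots> \<le> ((cosh t)\<^sup>2) ^ M"
    by (intro power_mono exp_b_le) simp
  finally show ?thesis
    by (simp add: power_mult[symmetric] mult.commute)
qed

text \<open>Let \<open>?m\<close> be the largest element of the symmetric difference. The sign at
  \<open>n + ?m\<close> is absent from the remaining factors of all products up to step
  \<open>n\<close>, so the products are the increments of a simple random walk. As \<open>b\<close>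
  is of order \<open>t\<^sup>2\<close>, the correlation costs only a fourth-order exponent.\<close>

lemma mean_exp_pair_le:
  assumes "A \<subseteq> {M..N-M}" "B \<subseteq> {M..N-M}" "A \<noteq> B"
  shows "mean I (\<lambda>x. exp (t * shift_sum M A x) * exp (t * shift_sum M B x))
       \<le> (cosh t ^ M)\<^sup>2 * exp (4 * t ^ 4 * M)"
proof -
  let ?D = "(A - B) \<union> (B - A)"
  let ?m = "Max ?D"
  have D: "finite ?D" "?D \<noteq> {}" "?D \<subseteq> {M..N-M}"
    using assms by (auto intro: finite_subset)
  have m: "?m \<in> ?D"
    using D by (intro Max_in)
  have prod: "shift_prod ?D n x = x (n + ?m, 1) * shift_prod (?D - {?m}) n x" for n x
    unfolding shift_prod_def using D m by (subst prod.remove[of _ ?m]) auto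
  have "mean I (\<lambda>x. exp (b * (\<Sum>n=1..M. shift_prod ?D n x)))
      = mean I (\<lambda>x. exp (b * (\<Sum>n=1..M. x (n + ?m, 1) * shift_prod (?D - {?m}) n x)))"
    by (simp only: prod)
  also have "\<dots> = cosh b ^ M"
  proof (rule mean_exp_adapted[OF fin])
    show "inj_on (\<lambda>n. (n + ?m, 1)) {1..M}"
      by (auto simp: inj_on_def)
    have "?m \<in> {M..N-M}"
      using m D(3) by (rule rev_subsetD)
    then show "(\<lambda>n. (n + ?m, 1)) ` {1..M} \<subseteq> I"
      using rows MN by (force intro: subsetD[OF rows])
    fix n m' x assume "1 \<le> m'" "m' \<le> n" "n \<le> M"
    have "a < ?m" if "a \<in> ?D - {?m}" for a
      using Max_ge[OF D(1), of a] that by fastforce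
    then have "n + ?m \<notin> (+) m' ` (?D - {?m})"
      using \<open>m' \<le> n\<close> by fastforce
    then show "shift_prod (?D - {?m}) m' (flip (n + ?m, 1) x) = shift_prod (?D - {?m}) m' x"
      by (rule shift_prod_flip)
  next
    fix n x assume "1 \<le> n" "n \<le> M" "x \<in> cube I"
    then show "shift_prod (?D - {?m}) n x = 1 \<or> shift_prod (?D - {?m}) n x = -1"
      using D(3) by (intro shift_prod_cases) auto
  qed
  also have "\<dots> \<le> exp (b\<^sup>2) ^ M"
  proof (intro power_mono cosh_le_exp_square b_nonneg)
    have "t\<^sup>2 \<le> (1/2)\<^sup>2"
      using t by (intro power_mono)
    then show "b \<le> 1"
      using b_le by (simp add: power2_eq_square)
  qed (simp add: cosh_real_nonneg)
  also have "\<dots> \<le> exp (4 * t ^ 4) ^ M"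
  proof (intro power_mono)
    have "b\<^sup>2 \<le> (2 * t\<^sup>2)\<^sup>2"
      by (intro power_mono b_le b_nonneg)
    then show "exp (b\<^sup>2) \<le> exp (4 * t ^ 4)"
      by (simp add: power_mult_distrib flip: power_mult)
  qed simp
  also have "\<dots> = exp (4 * t ^ 4 * M)"
    by (simp add: exp_of_nat2_mult)
  finally show ?thesis
    unfolding mean_exp_pair[OF assms(1,2)] using exp_bM_le
    by (intro mult_mono) (auto simp: mean_def intro!: divide_nonneg_nonneg sum_nonneg)
qed

text \<open>Here the symmetric difference is empty and every product is 1, giving
  \<open>exp (2 * b * M)\<close>. One factor \<open>exp (b * M)\<close> is compared with the squared
  mean, the other with the quadratic exponent.\<close>

lemma mean_exp_diag_le:
  assumes "A \<subseteq> {M..N-M}"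
  shows "mean I (\<lambda>x. exp (t * shift_sum M A x) * exp (t * shift_sum M A x))
       \<le> (cosh t ^ M)\<^sup>2 * exp (2 * t\<^sup>2 * M)"
proof -
  have "mean I (\<lambda>x. exp (t * shift_sum M A x) * exp (t * shift_sum M A x)) = exp (b * M) * exp (b * M)"
    unfolding mean_exp_pair[OF assms assms] by (simp add: shift_prod_def mean_const[OF fin])
  also have "\<dots> \<le> (cosh t ^ M)\<^sup>2 * exp (2 * t\<^sup>2 * M)"
    using b_le by (intro mult_mono exp_bM_le) (auto intro: mult_right_mono)
  finally show ?thesis .
qed

section \<open>First and second moments of the partition function\<close>

definition W :: "nat set set \<Rightarrow> (nat \<times> nat \<Rightarrow> real) \<Rightarrow> real" where
  "W F x = (\<Sum>A\<in>F. exp (t * shift_sum M A x))"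

lemma mean_W:
  assumes "\<And>A. A \<in> F \<Longrightarrow> A \<subseteq> {M..N-M}"
  shows "mean I (W F) = card F * cosh t ^ M"
proof -
  have "mean I (W F) = (\<Sum>A\<in>F. cosh t ^ M)"
    unfolding W_def mean_sum using assms by (intro sum.cong mean_exp_shift_sum) auto
  then show ?thesis by simp
qed

lemma mean_W_square_le:
  assumes "finite F" "\<And>A. A \<in> F \<Longrightarrow> A \<subseteq> {M..N-M}"
  shows "mean I (\<lambda>x. (W F x)\<^sup>2)
     \<le> (cosh t ^ M)\<^sup>2 * (card F * exp (2 * t\<^sup>2 * M) + (card F)\<^sup>2 * exp (4 * t ^ 4 * M))"
proof -
  let ?c = "(cosh t ^ M)\<^sup>2"
  have c: "0 \<le> ?c" by simp
  have "mean I (\<lambda>x. (W F x)\<^sup>2)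
      = (\<Sum>A\<in>F. \<Sum>B\<in>F. mean I (\<lambda>x. exp (t * shift_sum M A x) * exp (t * shift_sum M B x)))"
    unfolding W_def power2_eq_square sum_product mean_sum ..
  \<comment> \<open>The off-diagonal bound is added on the diagonal too, so that the double sum
    evaluates without a case split.\<close>
  also have "\<dots> \<le> (\<Sum>A\<in>F. \<Sum>B\<in>F. (if A = B then ?c * exp (2 * t\<^sup>2 * M) else 0) + ?c * exp (4 * t ^ 4 * M))"
  proof (intro sum_mono)
    fix A B assume "A \<in> F" "B \<in> F"
    then show "mean I (\<lambda>x. exp (t * shift_sum M A x) * exp (t * shift_sum M B x))
      \<le> (if A = B then ?c * exp (2 * t\<^sup>2 * M) else 0) + ?c * exp (4 * t ^ 4 * M)"
      using mean_exp_diag_le[of A] mean_exp_pair_le[of A B] assms(2)[of A] assms(2)[of B] c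
      by (cases "A = B") (auto intro: add_increasing2)
  qed
  also have "\<dots> = ?c * (card F * exp (2 * t\<^sup>2 * M) + (card F)\<^sup>2 * exp (4 * t ^ 4 * M))"
    using assms(1) by (simp add: sum.distrib power2_eq_square algebra_simps)
  finally show ?thesis .
qed

text \<open>The constant \<open>9 / 8\<close> bounds the variance of \<open>W F\<close> by an eighth
  of its squared mean, so by Chebyshev \<open>W F\<close> is at least half its mean with probability
  at least one half. There the largest exponential is at least the average one, and elsewhere
  \<open>f\<close> is nonnegative.\<close>

lemma mean_lower_bound:
  assumes "finite F" "F \<noteq> {}" "\<And>A. A \<in> F \<Longrightarrow> A \<subseteq> {M..N-M}"
    and small: "exp (2 * t\<^sup>2 * M) / card F + exp (4 * t ^ 4 * M) \<le> 9 / 8"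
    and f: "\<And>x. x \<in> cube I \<Longrightarrow> 0 \<le> f x"
      "\<And>x A. x \<in> cube I \<Longrightarrow> A \<in> F \<Longrightarrow> shift_sum M A x \<le> f x"
  shows "t\<^sup>2 * M / 4 - ln 2 \<le> 2 * (t * mean I f)"
proof -
  define m where "m = card F * cosh t ^ M"
  have D: "0 < real (card F)"
    using assms by (simp add: card_gt_0_iff)
  have m: "0 < m"
    using D by (simp add: m_def cosh_real_pos)
  have "c\<^sup>2 * (d * u + d\<^sup>2 * v) = (d * c)\<^sup>2 * (u / d + v)" if "0 < d" for c d u v :: real
    using that by (simp add: field_simps power2_eq_square)
  from this[OF D]
  have "mean I (\<lambda>x. (W F x)\<^sup>2) \<le> m\<^sup>2 * (exp (2 * t\<^sup>2 * M) / card F + exp (4 * t ^ 4 * M))"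
    using mean_W_square_le[OF assms(1,3)] by (simp add: m_def)
  also have "\<dots> \<le> m\<^sup>2 * (9 / 8)"
    by (intro mult_left_mono small) simp
  finally have var: "mean I (\<lambda>x. (W F x - m)\<^sup>2) \<le> m\<^sup>2 / 8"
    unfolding mean_sq_diff[OF fin] using mean_W[of F] assms(3)
    by (simp add: m_def[symmetric] power2_eq_square)
  define \<beta> where "\<beta> = t\<^sup>2 * M / 4 - ln 2"
  show ?thesis
  proof (cases "\<beta> \<le> 0")
    case True
    have "0 \<le> mean I f"
      using f(1) by (auto simp: mean_def intro!: divide_nonneg_nonneg sum_nonneg)
    then have "0 \<le> t * mean I f" using t by simp
    then show ?thesis using True by (simp add: \<beta>_def)
  next
    case False
    \<comment> \<open>Pointwise Chebyshev: for \<open>W F x \<ge> m / 2\<close> the bracket is at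
      most 1 and \<open>\<beta> \<le> t * f x\<close>; otherwise the bracket is nonpositive.\<close>
    have "\<beta> * (1 - 4 / m\<^sup>2 * (W F x - m)\<^sup>2) \<le> t * f x" if x: "x \<in> cube I" for x
    proof (cases "W F x \<ge> m / 2")
      case True
      have "card F * cosh t ^ M / 2 \<le> W F x"
        using True by (simp add: m_def)
      also have "\<dots> \<le> (\<Sum>A\<in>F. exp (t * f x))"
        unfolding W_def using f(2)[OF x] t by (intro sum_mono) (auto intro: mult_left_mono)
      finally have "cosh t ^ M / 2 \<le> exp (t * f x)"
        using D by simp
      moreover have "exp (t\<^sup>2 / 4) ^ M \<le> cosh t ^ M"
        using t by (intro power_mono exp_le_cosh) auto
      moreover have "exp \<beta> = exp (t\<^sup>2 / 4) ^ M / 2"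
        by (simp add: \<beta>_def exp_diff exp_of_nat2_mult[symmetric])
      ultimately have "exp \<beta> \<le> exp (t * f x)"
        by linarith
      then have "\<beta> \<le> t * f x" by simp
      moreover have "\<beta> * (1 - 4 / m\<^sup>2 * (W F x - m)\<^sup>2) \<le> \<beta> * 1"
        using False by (intro mult_left_mono) auto
      ultimately show ?thesis by simp
    next
      case W: False
      then have "(m / 2)\<^sup>2 \<le> (m - W F x)\<^sup>2"
        using m by (intro power_mono) auto
      then have "1 \<le> 4 / m\<^sup>2 * (W F x - m)\<^sup>2"
        using m by (simp add: field_simps power2_commute power_divide)
      then have "\<beta> * (1 - 4 / m\<^sup>2 * (W F x - m)\<^sup>2) \<le> 0"
        using False by (intro mult_nonneg_nonpos) auto
      also have "0 \<le> t * f x"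
        using f(1)[OF x] t by simp
      finally show ?thesis .
    qed
    then have "mean I (\<lambda>x. \<beta> * (1 - 4 / m\<^sup>2 * (W F x - m)\<^sup>2)) \<le> mean I (\<lambda>x. t * f x)"
      by (rule mean_mono)
    then have "\<beta> * (1 - 4 / m\<^sup>2 * mean I (\<lambda>x. (W F x - m)\<^sup>2)) \<le> t * mean I f"
      by (simp only: mean_cmult mean_diff mean_const[OF fin])
    moreover have "4 / m\<^sup>2 * mean I (\<lambda>x. (W F x - m)\<^sup>2) \<le> 4 / m\<^sup>2 * (m\<^sup>2 / 8)"
      by (intro mult_left_mono var) simp
    then have "\<beta> * (1 / 2) \<le> \<beta> * (1 - 4 / m\<^sup>2 * mean I (\<lambda>x. (W F x - m)\<^sup>2))"
      using m False by (intro mult_left_mono) auto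
    ultimately show ?thesis
      by (simp add: \<beta>_def)
  qed
qed

end

section \<open>Reduction of the cross-correlation measure to the cube\<close>

definition corr_sum :: "nat \<Rightarrow> nat \<Rightarrow> nat list \<Rightarrow> nat list \<Rightarrow> (nat \<Rightarrow> nat \<Rightarrow> real) \<Rightarrow> real" where
  "corr_sum k M d s e = (\<Sum>n=1..M. \<Prod>i<k. e (n + d ! i) (s ! i))"

lemma finite_cross_corr_values:
  fixes e :: "nat \<Rightarrow> nat \<Rightarrow> real"
  assumes "1 \<le> k"
  shows "finite {\<bar>\<Sum>n = 1..M. \<Prod>i<k. e (n + d ! i) (s ! i)\<bar> | M d s. admissible N S k M d s}"
    (is "finite ?V")
proof -
  let ?L = "\<lambda>b. {xs :: nat list. set xs \<subseteq> {0..b} \<and> length xs = k}"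
  have "?V \<subseteq> (\<lambda>(M, d, s). \<bar>corr_sum k M d s e\<bar>) ` ({..N} \<times> ?L N \<times> ?L S)"
  proof
    fix v assume "v \<in> ?V"
    then obtain M d s where v: "v = \<bar>corr_sum k M d s e\<bar>" and adm: "admissible N S k M d s"
      by (auto simp: corr_sum_def)
    \<comment> \<open>The lag list is nonempty since \<open>k \<ge> 1\<close>; this is what bounds
      \<open>M\<close>, which empty lists would leave free.\<close>
    have "M + d ! 0 \<le> N"
      using adm assms by (auto simp: admissible_def)
    moreover have "\<forall>i<length d. d ! i \<le> N" "\<forall>i<length s. s ! i \<le> S"
      using adm by (auto simp: admissible_def)
    ultimately show "v \<in> (\<lambda>(M, d, s). \<bar>corr_sum k M d s e\<bar>) ` ({..N} \<times> ?L N \<times> ?L S)"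
      using adm unfolding v by (intro image_eqI[of _ _ "(M, d, s)"]) (auto simp: admissible_def in_set_conv_nth)
  qed
  then show ?thesis
    by (rule finite_subset) (auto intro!: finite_imageI finite_cartesian_product finite_lists_length_eq)
qed

lemma cross_corr_ge:
  assumes "1 \<le> k" "admissible N S k M d s"
  shows "\<bar>corr_sum k M d s e\<bar> \<le> cross_corr N S k e"
  unfolding cross_corr_def corr_sum_def
  by (rule Max_ge[OF finite_cross_corr_values[OF assms(1)]]) (use assms(2) in blast)

lemma cross_corr_attained:
  assumes "1 \<le> k" "admissible N S k M0 d0 s0"
  obtains M d s where "admissible N S k M d s" "cross_corr N S k e = \<bar>corr_sum k M d s e\<bar>"
proof -
  have "cross_corr N S k e \<in> {\<bar>\<Sum>n = 1..M. \<Prod>i<k. e (n + d ! i) (s ! i)\<bar> | M d s. admissible N S k M d s}"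
    unfolding cross_corr_def
    by (rule Max_in[OF finite_cross_corr_values[OF assms(1)]]) (use assms(2) in blast)
  then show thesis
    using that by (auto simp: corr_sum_def)
qed

section \<open>Effect of one sign flip\<close>

lemma curry_flip_apply: "(n, s) \<noteq> i \<Longrightarrow> curry (flip i x) n s = curry x n s"
  by (simp add: curry_def)

lemma corr_sum_flip_le:
  assumes adm: "admissible N S k M d s" and x: "x \<in> cube ({1..N} \<times> {1..S})"
  shows "\<bar>corr_sum k M d s (curry (flip i x)) - corr_sum k M d s (curry x)\<bar> \<le> 2 * real k"
proof -
  obtain m r where i: "i = (m, r)" by (cases i)
  \<comment> \<open>Every \<open>n\<close> with \<open>n + d ! j = m\<close> for some
    \<open>j\<close> lies in \<open>T\<close>. Truncated subtraction only contributes 0, which is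
    outside \<open>{1..M}\<close>. Each summand is a sign, so it moves by at most 2.\<close>
  define T where "T = (\<lambda>j. m - d ! j) ` {..<k}"
  let ?P = "\<lambda>y n. \<Prod>j<k. curry y (n + d ! j) (s ! j)"
  have P1: "\<bar>?P y n\<bar> = 1" if "y \<in> cube ({1..N} \<times> {1..S})" "n \<in> {1..M}" for y n
  proof -
    have "\<bar>?P y n\<bar> = (\<Prod>j<k. 1)"
      unfolding abs_prod
    proof (rule prod.cong)
      fix j assume "j \<in> {..<k}"
      then have "(n + d ! j, s ! j) \<in> {1..N} \<times> {1..S}"
        using adm that(2) by (fastforce simp: admissible_def)
      then show "\<bar>curry y (n + d ! j) (s ! j)\<bar> = 1"
        using cube_values[OF that(1)] by (fastforce simp: curry_def)
    qed simp
    then show ?thesis by simp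
  qed
  have summand: "\<bar>?P (flip i x) n - ?P x n\<bar> \<le> (if n \<in> T then 2 else 0)" if n: "n \<in> {1..M}" for n
  proof (cases "n \<in> T")
    case True
    have "\<bar>?P (flip i x) n - ?P x n\<bar> \<le> \<bar>?P (flip i x) n\<bar> + \<bar>?P x n\<bar>"
      by linarith
    then show ?thesis
      using True P1[OF x n] P1[OF flip_in_cube[OF x] n] by simp
  next
    case False
    have "?P (flip i x) n = ?P x n"
    proof (intro prod.cong refl curry_flip_apply)
      fix j assume "j \<in> {..<k}"
      then have "n \<noteq> m - d ! j"
        using False by (auto simp: T_def)
      then show "(n + d ! j, s ! j) \<noteq> i"
        by (auto simp: i)
    qed
    then show ?thesis
      using False by simp
  qed
  have "\<bar>corr_sum k M d s (curry (flip i x)) - corr_sum k M d s (curry x)\<bar>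
      \<le> (\<Sum>n=1..M. if n \<in> T then 2 else 0)"
    unfolding corr_sum_def sum_subtractf[symmetric]
    by (rule order_trans[OF sum_abs sum_mono]) (rule summand)
  also have "\<dots> = 2 * real (card ({1..M} \<inter> T))"
    by (simp add: sum.If_cases)
  also have "card ({1..M} \<inter> T) \<le> card T"
    by (rule card_mono) (auto simp: T_def)
  also have "card T \<le> k"
    unfolding T_def using card_image_le[of "{..<k}"] by simp
  finally show ?thesis by simp
qed

lemma cross_corr_flip_le:
  assumes k: "1 \<le> k" and adm: "admissible N S k M0 d0 s0" and x: "x \<in> cube ({1..N} \<times> {1..S})"
  shows "\<bar>cross_corr N S k (curry (flip i x)) - cross_corr N S k (curry x)\<bar> \<le> 2 * real k"
proof -
  have "cross_corr N S k (curry (flip i y)) - cross_corr N S k (curry y) \<le> 2 * real k"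
    if y: "y \<in> cube ({1..N} \<times> {1..S})" for y
  proof -
    obtain M d s where a: "admissible N S k M d s"
      "cross_corr N S k (curry (flip i y)) = \<bar>corr_sum k M d s (curry (flip i y))\<bar>"
      by (rule cross_corr_attained[OF k adm])
    show ?thesis
      using corr_sum_flip_le[OF a(1) y, of i] cross_corr_ge[OF k a(1), of "curry y"] a(2) by linarith
  qed
  \<comment> \<open>The instance at \<open>flip i x\<close>, whose flip is \<open>x\<close>, is the
    reverse inequality.\<close>
  from this[OF x] this[OF flip_in_cube[OF x], of i] show ?thesis
    by simp
qed

section \<open>Shift sums as admissible correlations\<close>

lemma admissible_subset:
  assumes "1 \<le> M" "2 * M \<le> N" "1 \<le> S" "A \<subseteq> {M..N-M}"
  shows "admissible N S (Suc (card A)) M (0 # sorted_list_of_set A) (replicate (Suc (card A)) 1)"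
proof -
  let ?l = "sorted_list_of_set A"
  have fin: "finite A"
    using assms(4) by (rule finite_subset) simp
  have len: "length ?l = card A" and set: "set ?l = A"
    using fin by simp_all
  have mem: "?l ! i \<in> A" if "i < card A" for i
    using that set nth_mem[of i ?l] len by auto
  \<comment> \<open>Strict because every element of \<open>A\<close> is at least
    \<open>M \<ge> 1\<close>; distinct lags permit the same sequence throughout.\<close>
  have "sorted_wrt (<) (0 # ?l)"
    using assms(1,4) fin by (auto simp: strict_sorted_list_of_set)
  then have lt: "(0 # ?l) ! i < (0 # ?l) ! j" if "i < j" "j < Suc (card A)" for i j
    using that len by (auto simp: sorted_wrt_iff_nth_less)
  have "M + (0 # ?l) ! i \<le> N" if "i < Suc (card A)" for i
  proof (cases i)
    case (Suc j)
    then have "?l ! j \<in> {M..N-M}"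
      using that mem[of j] assms(4) by auto
    then show ?thesis
      using Suc assms(2) by auto
  qed (use assms in auto)
  moreover have "(0 # ?l) ! i \<le> (0 # ?l) ! j" if "i \<le> j" "j < Suc (card A)" for i j
    using lt[of i j] that by (cases "i = j") auto
  moreover have "(0 # ?l) ! i \<noteq> (0 # ?l) ! j" if "i < Suc (card A)" "j < Suc (card A)" "i \<noteq> j" for i j
    using lt[of i j] lt[of j i] that by (cases "i < j") auto
  ultimately show ?thesis
    using assms len unfolding admissible_def by (auto simp del: replicate_Suc)
qed

lemma corr_sum_subset:
  assumes "finite A"
  shows "corr_sum (Suc (card A)) M (0 # sorted_list_of_set A) (replicate (Suc (card A)) 1) (curry x)
       = shift_sum M A x"
proof -
  let ?l = "sorted_list_of_set A"
  have "(\<Prod>i<Suc (card A). curry x (n + (0 # ?l) ! i) (replicate (Suc (card A)) 1 ! i))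
      = x (n, 1) * shift_prod A n x" for n
  proof -
    have "(\<Prod>i<Suc (card A). curry x (n + (0 # ?l) ! i) (replicate (Suc (card A)) 1 ! i))
        = (\<Prod>i<Suc (card A). x (n + (0 # ?l) ! i, 1))"
      by (intro prod.cong refl) (simp del: replicate_Suc)
    also have "\<dots> = x (n, 1) * (\<Prod>i<card A. x (n + ?l ! i, 1))"
      by (subst prod.lessThan_Suc_shift) simp
    also have "(\<Prod>i<card A. x (n + ?l ! i, 1)) = (\<Prod>a\<in>A. x (n + a, 1))"
    proof (rule prod.reindex_bij_betw)
      show "bij_betw ((!) ?l) {..<card A} A"
        using bij_betw_nth[of ?l "{..<card A}" A] assms by simp
    qed
    finally show ?thesis
      by (simp add: shift_prod_def)
  qed
  then show ?thesis
    by (simp only: corr_sum_def shift_sum_def)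
qed

section \<open>Random sign arrays as uniform points of the cube\<close>

lemma sign_arrays_eq: "sign_arrays N S = curry ` cube ({1..N} \<times> {1..S})"
proof (intro equalityI subsetI)
  fix e assume "e \<in> sign_arrays N S"
  then have "e = curry (case_prod e)" "case_prod e \<in> cube ({1..N} \<times> {1..S})"
    by (auto simp: sign_arrays_def PiE_dflt_def)
  then show "e \<in> curry ` cube ({1..N} \<times> {1..S})"
    by blast
qed (auto simp: sign_arrays_def PiE_dflt_def curry_def)

lemma inj_curry: "inj_on curry X"
  by (rule inj_onI) (metis case_prod_curry)

lemma finite_sign_arrays: "finite (sign_arrays N S)"
  unfolding sign_arrays_eq by (intro finite_imageI finite_cube) simp

lemma card_sign_arrays: "card (sign_arrays N S) = 2 ^ card ({1..N} \<times> {1..S})"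
  unfolding sign_arrays_eq card_image[OF inj_curry] by (rule card_cube) simp

lemma sign_arrays_nonempty: "sign_arrays N S \<noteq> {}"
  using card_sign_arrays[of N S] by auto

lemma expectation_sign_arrays:
  "measure_pmf.expectation (pmf_of_set (sign_arrays N S)) f
     = mean ({1..N} \<times> {1..S}) (\<lambda>x. f (curry x))"
  unfolding integral_pmf_of_set[OF sign_arrays_nonempty finite_sign_arrays] card_sign_arrays
  by (simp add: mean_def sign_arrays_eq sum.reindex[OF inj_curry])

text \<open>Chebyshev's inequality: the indicator of the event dominates
  \<open>1 - (f - \<mu>)\<^sup>2 / (\<epsilon> * \<mu>)\<^sup>2\<close> pointwise.\<close>

lemma prob_ge_of_mean_sq:
  assumes pos: "0 < \<epsilon>" and \<mu>: "0 < \<mu>"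
    and var: "mean ({1..N} \<times> {1..S}) (\<lambda>x. (f (curry x) - \<mu>)\<^sup>2) \<le> \<epsilon>\<^sup>2 * \<mu>\<^sup>2 * \<delta>"
  shows "measure_pmf.prob (pmf_of_set (sign_arrays N S)) {e. 1 - \<epsilon> < f e / \<mu> \<and> f e / \<mu> < 1 + \<epsilon>} \<ge> 1 - \<delta>"
    (is "measure_pmf.prob _ ?A \<ge> _")
proof -
  let ?I = "{1..N} \<times> {1..S}"
  have "1 - \<delta> \<le> 1 - 1 / (\<epsilon>\<^sup>2 * \<mu>\<^sup>2) * mean ?I (\<lambda>x. (f (curry x) - \<mu>)\<^sup>2)"
    using var pos \<mu> by (simp add: field_simps)
  also have "\<dots> = mean ?I (\<lambda>x. 1 - 1 / (\<epsilon>\<^sup>2 * \<mu>\<^sup>2) * (f (curry x) - \<mu>)\<^sup>2)"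
    by (simp only: mean_diff mean_cmult mean_const[OF finite_cartesian_product[OF finite_atLeastAtMost finite_atLeastAtMost]])
  also have "\<dots> \<le> mean ?I (\<lambda>x. indicator ?A (curry x))"
  proof (rule mean_mono)
    fix x
    show "1 - 1 / (\<epsilon>\<^sup>2 * \<mu>\<^sup>2) * (f (curry x) - \<mu>)\<^sup>2 \<le> indicator ?A (curry x)"
    proof (cases "curry x \<in> ?A")
      case False
      have "\<epsilon> * \<mu> \<le> \<bar>f (curry x) - \<mu>\<bar>"
        using False \<mu> by (auto simp: field_simps)
      then have "(\<epsilon> * \<mu>)\<^sup>2 \<le> \<bar>f (curry x) - \<mu>\<bar>\<^sup>2"
        using pos \<mu> by (intro power_mono) auto
      then show ?thesis
        using False pos \<mu> by (simp add: field_simps)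
    qed simp
  qed
  also have "\<dots> = measure_pmf.prob (pmf_of_set (sign_arrays N S)) ?A"
    unfolding expectation_sign_arrays[symmetric] by simp
  finally show ?thesis .
qed

section \<open>Concentration\<close>

lemma mean_cross_corr_square_ge:
  fixes N S k :: nat and L :: real
  defines "L \<equiv> ln (real N)"
  assumes S: "1 \<le> S" and k: "2 \<le> k" "real k \<le> L"
    and L: "64 \<le> L" "3 * L \<le> sqrt N" "8 * L ^ 4 \<le> N" "2 * L\<^sup>2 \<le> N"
  shows "0 < mean ({1..N} \<times> {1..S}) (\<lambda>x. cross_corr N S k (curry x))" (is "0 < ?\<mu>")
    and "real k * L * N / 16384 \<le> (mean ({1..N} \<times> {1..S}) (\<lambda>x. cross_corr N S k (curry x)))\<^sup>2"
    and "\<exists>M d s. admissible N S k M d s"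
proof -
  define M where "M = N div 3"
  \<comment> \<open>The lag 0 takes one of the \<open>k\<close> factors; \<open>n\<close> below
    counts the available shifts \<open>{M..N-M}\<close>.\<close>
  define \<kappa> where "\<kappa> = k - 1"
  define n where "n = N - M + 1 - M"
  define F where "F = {A. A \<subseteq> {M..N-M} \<and> card A = \<kappa>}"
  \<comment> \<open>The diagonal costs \<open>exp (2 * \<Lambda>)\<close>, while
    \<open>card F\<close> is at least \<open>exp (\<kappa> * L / 2) = exp (4 * \<Lambda>)\<close>.
    The choice of \<open>t\<close> gives \<open>t\<^sup>2 * M = \<Lambda>\<close>.\<close>
  define \<Lambda> where "\<Lambda> = real \<kappa> * L / 8"
  define t where "t = sqrt (\<Lambda> / M)"
  have "0 < N"
    using L(1) by (cases N) (auto simp: L_def)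
  have N: "12 \<le> real N" "3 * L \<le> N"
  proof -
    have "L * 1 \<le> L * L"
      using L by (intro mult_left_mono) auto
    then have "2 * L \<le> N"
      using L(4) unfolding power2_eq_square by linarith
    then have "1 \<le> real N" using L by linarith
    then have "sqrt N * 1 \<le> sqrt N * sqrt N"
      by (intro mult_left_mono) auto
    then show "3 * L \<le> N" using L by simp
    then show "12 \<le> real N" using L by simp
  qed
  have M: "real N / 4 \<le> M" "3 * M \<le> N" "0 < real M"
  proof -
    have "real N / 3 - 1 \<le> M"
      unfolding M_def by linarith
    then show "real N / 4 \<le> M" "0 < real M"
      using N by linarith+
  qed (simp add: M_def)
  have \<kappa>: "1 \<le> real \<kappa>" "real k \<le> 2 * real \<kappa>" "real \<kappa> \<le> L" "k = Suc \<kappa>"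
    using k by (auto simp: \<kappa>_def of_nat_diff)
  have n: "real N / 3 \<le> n"
    using M by (simp add: n_def of_nat_diff)
  have \<kappa>n: "\<kappa> \<le> n"
    using n \<kappa>(3) N by linarith
  have cF: "card F = n choose \<kappa>" and finF: "finite F"
    using n_subsets[of "{M..N-M}" \<kappa>] M by (simp_all add: F_def n_def Suc_diff_le)
  have D: "exp (\<kappa> * L / 2) \<le> card F"
  proof -
    \<comment> \<open>Combines \<open>n \<ge> N / 3\<close> with
      \<open>3 * \<kappa> \<le> 3 * L \<le> sqrt N\<close>; each chosen shift thus adds
      \<open>L / 2\<close> to the logarithm of \<open>card F\<close>.\<close>
    have "sqrt N \<le> n / \<kappa>"
    proof -
      have "sqrt N * (3 * \<kappa>) \<le> sqrt N * sqrt N"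
        using \<kappa> L by (intro mult_left_mono) auto
      then have "sqrt N * \<kappa> \<le> n"
        using n by simp
      then show ?thesis
        using \<kappa> by (simp add: field_simps)
    qed
    moreover have "sqrt N = exp (L / 2)"
      using \<open>0 < N\<close> by (simp add: L_def powr_half_sqrt[symmetric] powr_def)
    ultimately have "exp (L / 2) ^ \<kappa> \<le> (real n / \<kappa>) ^ \<kappa>"
      by (intro power_mono) auto
    also have "\<dots> \<le> card F"
      unfolding cF by (rule binomial_ge_n_over_k_pow_k[OF \<kappa>n])
    finally show ?thesis
      by (simp add: exp_of_nat_mult[symmetric])
  qed
  have Fne: "F \<noteq> {}"
    using D by (metis card.empty exp_gt_zero linorder_not_less of_nat_0)
  have \<kappa>L: "64 \<le> \<kappa> * L"
    using mult_mono[OF \<kappa>(1) L(1)] \<kappa> by simp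
  have \<Lambda>: "8 \<le> \<Lambda>" "\<Lambda> \<le> L\<^sup>2 / 8"
    using \<kappa>L \<kappa> L by (auto simp: \<Lambda>_def power2_eq_square intro: mult_right_mono)
  have t_eq: "0 < t" "t\<^sup>2 * M = \<Lambda>"
    using \<Lambda> M by (auto simp: t_def)
  have t2: "t \<le> 1 / 2"
  proof -
    have "\<Lambda> / M \<le> (1/2)\<^sup>2"
      using \<Lambda> L M by (simp add: field_simps power2_eq_square)
    then show ?thesis
      unfolding t_def by (intro real_le_lsqrt) auto
  qed
  have adm: "admissible N S k M (0 # sorted_list_of_set A) (replicate k 1)" if "A \<in> F" for A
    using admissible_subset[of M N S A] that M S by (auto simp: F_def \<kappa>(4))
  then show "\<exists>M d s. admissible N S k M d s"
    using Fne by blast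
  have ge: "shift_sum M A x \<le> cross_corr N S k (curry x)" if "A \<in> F" for A x
  proof -
    have "finite A"
      using that by (auto simp: F_def intro: finite_subset)
    then show ?thesis
      using cross_corr_ge[OF _ adm[OF that], of "curry x"] corr_sum_subset[of A M x] k that
      by (simp add: F_def \<kappa>(4) del: replicate_Suc)
  qed
  have nonneg: "0 \<le> cross_corr N S k e" for e
    using cross_corr_ge[OF _ adm, of _ e] Fne k by fastforce
  interpret shifts M N "{1..N} \<times> {1..S}" t
    using M S t_eq t2 by unfold_locales auto
  \<comment> \<open>The diagonal gets \<open>1 / 16\<close> and the other pairs
    \<open>1 + 1 / 16\<close>; the latter works because \<open>\<Lambda>\<^sup>2 / M\<close> is of
    order at most \<open>L ^ 4 / N\<close>.\<close>
  have "exp (2 * t\<^sup>2 * M) / card F + exp (4 * t ^ 4 * M) \<le> 9 / 8"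
  proof -
    have "exp (2 * t\<^sup>2 * M) / card F \<le> exp (2 * \<Lambda>) / exp (\<kappa> * L / 2)"
      using D t_eq(2) by (intro frac_le) (auto simp: mult.assoc)
    also have "\<dots> = 1 / exp (\<kappa> * L / 4)"
    proof -
      have "exp (2 * \<Lambda>) * exp (\<kappa> * L / 4) = exp (\<kappa> * L / 2)"
        by (simp add: \<Lambda>_def exp_add[symmetric])
      then show ?thesis
        by (simp add: field_simps)
    qed
    also have "\<dots> \<le> 1 / (1 + \<kappa> * L / 4)"
      using \<kappa>L by (intro divide_left_mono mult_pos_pos exp_ge_add_one_self exp_gt_zero; linarith)
    also have "\<dots> \<le> 1 / 16"
      using \<kappa>L by (intro divide_left_mono mult_pos_pos; linarith)
    finally have 1: "exp (2 * t\<^sup>2 * M) / card F \<le> 1 / 16" .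
    have "4 * t ^ 4 * M = 4 * \<Lambda>\<^sup>2 / M"
      using M by (simp add: t_eq(2)[symmetric] field_simps power2_eq_square power4_eq_xxxx)
    also have "\<dots> \<le> 4 * (L\<^sup>2 / 8)\<^sup>2 / (N / 4)"
      using \<Lambda> M N by (intro frac_le mult_left_mono power_mono) auto
    also have "\<dots> \<le> 1 / 32"
      using L(3) N by (simp add: field_simps power2_eq_square power4_eq_xxxx)
    finally have "4 * t ^ 4 * M \<le> 1 / 32" .
    then have "exp (4 * t ^ 4 * M) \<le> 1 + 2 * (1 / 32)"
      using real_exp_bound_lemma[of "4 * t ^ 4 * M"] t_eq by simp
    then show ?thesis
      by (rule order_trans[OF add_mono[OF 1]]) simp
  qed
  then have "\<Lambda> / 4 - ln 2 \<le> 2 * (t * ?\<mu>)"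
    using mean_lower_bound[OF finF Fne, of "\<lambda>x. cross_corr N S k (curry x)"] nonneg ge t_eq(2)
    by (auto simp: F_def)
  moreover have "ln 2 \<le> (1 :: real)"
    using ln_le_minus_one[of "2 :: real"] by simp
  \<comment> \<open>\<open>\<Lambda> \<ge> 8\<close> lets half of the main term absorb
    \<open>ln 2\<close>.\<close>
  ultimately have \<mu>: "\<Lambda> / 8 \<le> 2 * (t * ?\<mu>)"
    using \<Lambda> by linarith
  then have "0 < t * ?\<mu>"
    using \<Lambda> by linarith
  then show "0 < ?\<mu>"
    using t_eq by (simp add: zero_less_mult_iff)
  have "(\<Lambda> / 8)\<^sup>2 \<le> (2 * (t * ?\<mu>))\<^sup>2"
    using \<mu> \<Lambda> by (intro power_mono) auto
  also have "\<dots> * M = 4 * \<Lambda> * ?\<mu>\<^sup>2"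
    by (simp add: t_eq(2)[symmetric] power2_eq_square)
  finally have "(\<Lambda> / 8)\<^sup>2 * M \<le> 4 * \<Lambda> * ?\<mu>\<^sup>2"
    using M by simp
  then have "\<Lambda> * M / 256 \<le> ?\<mu>\<^sup>2"
    using \<Lambda> by (simp add: power2_eq_square field_simps)
  \<comment> \<open>From \<open>\<kappa> \<ge> k / 2\<close> and \<open>M \<ge> N / 4\<close>; the
    constant is \<open>64 * 256 = 16384\<close>.\<close>
  moreover have "(real k / 2) * L / 8 * (N / 4) \<le> \<Lambda> * M"
    unfolding \<Lambda>_def using \<kappa> L M by (intro mult_mono divide_right_mono) auto
  ultimately show "real k * L * N / 16384 \<le> ?\<mu>\<^sup>2"
    by simp
qed

text \<open>The variance is at most \<open>N * S * k\<^sup>2\<close>, and \<open>kL\<close> makes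
  this at most \<open>\<epsilon> ^ 3\<close> times the squared mean: two powers of \<epsilon> pay
  for the relative deviation, one for the failure probability.\<close>

lemma cross_corr_concentration:
  fixes N S k :: nat and \<epsilon> L :: real and P
  defines "L \<equiv> ln (real N)" and "P \<equiv> pmf_of_set (sign_arrays N S)"
  assumes S: "1 \<le> S" and k: "2 \<le> k" "real k \<le> L" and \<epsilon>: "0 < \<epsilon>"
    and L: "64 \<le> L" "3 * L \<le> sqrt N" "8 * L ^ 4 \<le> N" "2 * L\<^sup>2 \<le> N"
    and kL: "16384 * S * k \<le> \<epsilon> ^ 3 * L"
  shows "measure_pmf.prob P
       {e. 1 - \<epsilon> < cross_corr N S k e / measure_pmf.expectation P (cross_corr N S k)
         \<and> cross_corr N S k e / measure_pmf.expectation P (cross_corr N S k) < 1 + \<epsilon>} \<ge> 1 - \<epsilon>"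
proof -
  let ?I = "{1..N} \<times> {1..S}"
  define \<mu> where "\<mu> = mean ?I (\<lambda>x. cross_corr N S k (curry x))"
  note lower = mean_cross_corr_square_ge[OF S k(1) k(2)[unfolded L_def] L[unfolded L_def],
      folded L_def \<mu>_def]
  obtain M d s where adm: "admissible N S k M d s"
    using lower(3) by blast
  have "mean ?I (\<lambda>x. (cross_corr N S k (curry x) - \<mu>)\<^sup>2) \<le> card ?I * (2 * real k)\<^sup>2 / 4"
    unfolding \<mu>_def using k adm
    by (intro efron_stein_bounded_differences cross_corr_flip_le) auto
  also have "\<dots> = real N * k * (S * k)"
    by (simp add: power2_eq_square)
  also have "\<dots> \<le> real N * k * (\<epsilon> ^ 3 * L / 16384)"
    using kL by (intro mult_left_mono) auto
  also have "\<dots> = \<epsilon> ^ 3 * (real k * L * N / 16384)"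
    by simp
  also have "\<dots> \<le> \<epsilon> ^ 3 * \<mu>\<^sup>2"
    using lower(2) \<epsilon> by (intro mult_left_mono) auto
  also have "\<dots> = \<epsilon>\<^sup>2 * \<mu>\<^sup>2 * \<epsilon>"
    by (simp add: power2_eq_square power3_eq_cube)
  finally show ?thesis
    unfolding P_def expectation_sign_arrays \<mu>_def[symmetric]
    by (rule prob_ge_of_mean_sq[OF \<epsilon> lower(1)])
qed

theorem theorem2:
  fixes S :: nat and \<epsilon> :: real and k :: "nat \<Rightarrow> nat"
  assumes "S \<ge> 1" and "\<epsilon> > 0"
    and "\<forall>\<^sub>F N in sequentially. 2 \<le> k N \<and> real (k N) \<le> (ln (real N) + ln (real S)) / ln (ln (real N))"
  shows "\<exists>N0::nat. real N0 \<ge> 12 * log 2 (real S) \<and>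
    (\<forall>N \<ge> N0.
      measure_pmf.prob (pmf_of_set (sign_arrays N S))
        {e. 1 - \<epsilon> < cross_corr N S (k N) e /
                   measure_pmf.expectation (pmf_of_set (sign_arrays N S)) (cross_corr N S (k N))
          \<and> cross_corr N S (k N) e /
                   measure_pmf.expectation (pmf_of_set (sign_arrays N S)) (cross_corr N S (k N))
            < 1 + \<epsilon>} \<ge> 1 - \<epsilon>)"
proof -
  \<comment> \<open>The bound 1 will give \<open>k N \<le> ln N\<close>, the other the smallness
    condition on \<open>S * k N\<close>.\<close>
  define \<delta> where "\<delta> = min 1 (\<epsilon> ^ 3 / (16384 * S))"
  have \<delta>: "0 < \<delta>"
    using assms by (simp add: \<delta>_def)
  \<comment> \<open>For fixed \<open>S\<close> the permitted order is of smaller order than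
    \<open>ln N\<close>.\<close>
  have "((\<lambda>N::nat. (ln (real N) + ln (real S)) / ln (ln (real N)) / ln (real N)) \<longlongrightarrow> 0) sequentially"
    by real_asymp
  then have "\<forall>\<^sub>F N::nat in sequentially. (ln (real N) + ln (real S)) / ln (ln (real N)) / ln (real N) < \<delta>"
    using \<delta> by (rule order_tendstoD(2))
  moreover have "\<forall>\<^sub>F N::nat in sequentially. 64 \<le> ln (real N)"
    "\<forall>\<^sub>F N::nat in sequentially. 3 * ln (real N) \<le> sqrt (real N)"
    "\<forall>\<^sub>F N::nat in sequentially. 8 * ln (real N) ^ 4 \<le> real N"
    "\<forall>\<^sub>F N::nat in sequentially. 2 * (ln (real N))\<^sup>2 \<le> real N"
    by real_asymp+
  ultimately have "\<forall>\<^sub>F N in sequentially.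
      measure_pmf.prob (pmf_of_set (sign_arrays N S))
        {e. 1 - \<epsilon> < cross_corr N S (k N) e /
                   measure_pmf.expectation (pmf_of_set (sign_arrays N S)) (cross_corr N S (k N))
          \<and> cross_corr N S (k N) e /
                   measure_pmf.expectation (pmf_of_set (sign_arrays N S)) (cross_corr N S (k N))
            < 1 + \<epsilon>} \<ge> 1 - \<epsilon>"
    using assms(3)
  proof eventually_elim
    case (elim N)
    have L: "0 < ln (real N)"
      using elim(2) by simp
    have "real (k N) / ln (real N) \<le> (ln (real N) + ln (real S)) / ln (ln (real N)) / ln (real N)"
      using elim(6) L by (intro divide_right_mono) auto
    then have "real (k N) / ln (real N) \<le> \<delta>"
      using elim(1) by linarith
    then have "real (k N) \<le> \<delta> * ln (real N)"
      using L by (simp add: field_simps)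
    moreover have "\<delta> * ln (real N) \<le> 1 * ln (real N)"
      "\<delta> * ln (real N) \<le> \<epsilon> ^ 3 / (16384 * S) * ln (real N)"
      using L by (intro mult_right_mono; simp add: \<delta>_def)+
    ultimately have "real (k N) \<le> ln (real N)" "real (k N) \<le> \<epsilon> ^ 3 / (16384 * S) * ln (real N)"
      by linarith+
    then show ?case
      using elim assms(1,2) by (intro cross_corr_concentration) (auto simp: field_simps)
  qed
  then obtain N1 where N1: "\<And>N. N \<ge> N1 \<Longrightarrow>
      measure_pmf.prob (pmf_of_set (sign_arrays N S))
        {e. 1 - \<epsilon> < cross_corr N S (k N) e /
                   measure_pmf.expectation (pmf_of_set (sign_arrays N S)) (cross_corr N S (k N))
          \<and> cross_corr N S (k N) e /
                   measure_pmf.expectation (pmf_of_set (sign_arrays N S)) (cross_corr N S (k N))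
            < 1 + \<epsilon>} \<ge> 1 - \<epsilon>"
    unfolding eventually_sequentially by blast
  \<comment> \<open>Enlarging the threshold secures the required lower bound on
    \<open>N0\<close>.\<close>
  have "12 * log 2 (real S) \<le> real (max N1 (nat \<lceil>12 * log 2 (real S)\<rceil>))"
    by linarith
  then show ?thesis
    using N1 by (intro exI[of _ "max N1 (nat \<lceil>12 * log 2 (real S)\<rceil>)"]) auto
qed

end
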